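(* Let $\mathbb A,B\in GL_N(\mathbb C)$ be endowed with the Poisson brackets $$\{\overset{1}{\mathbb A},\overset{2}{\mathbb A}\}=r_{12}\overset{1}{\mathbb A}\overset{2}{\mathbb A}-\overset{1}{\mathbb A}\overset{2}{\mathbb A}r_{12}+\overset{1}{\mathbb A}r_{12}^{t_1}\overset{2}{\mathbb A}-\overset{2}{\mathbb A}r_{12}^{t_1}\overset{1}{\mathbb A},\quad \{\overset{1}{B},\overset{2}{B}\}=r_{12}\overset{1}{B}\overset{2}{B}-\overset{1}{B}\overset{2}{B}r_{12},\quad \{\overset{1}{B},\overset{2}{\mathbb A}\}=\overset{1}{B}Q_{12}\overset{2}{\mathbb A}+\overset{1}{B}\overset{2}{\mathbb A}Q_{12}^{t_2},$$ with $Q_{12}$ of type (ii), $Q_{12}=-r_{12}^{t_2}$, or of type (iii), $Q_{12}=r_{12}^{t_1}$. Put $\mathbb A':=\mathbb A^{-1}$ and $B':=B^{-\mathrm T}$. Then $$\{\overset{1}{\mathbb A'},\overset{2}{\mathbb A'}\}=-\bigl(r_{12}\overset{1}{\mathbb A'}\overset{2}{\mathbb A'}-\overset{1}{\mathbb A'}\overset{2}{\mathbb A'}r_{12}+\overset{1}{\mathbb A'}r_{12}^{t_1}\overset{2}{\mathbb A'}-\overset{2}{\mathbb A'}r_{12}^{t_1}\overset{1}{\mathbb A'}\bigr),$$ $$\{\overset{1}{B'},\overset{2}{B'}\}=-\bigl(r_{12}\overset{1}{B'}\overset{2}{B'}-\overset{1}{B'}\overset{2}{B'}r_{12}\bigr),\qquad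 \{\overset{1}{B'},\overset{2}{\mathbb A'}\}=-\bigl(\overset{1}{B'}Q'_{12}\overset{2}{\mathbb A'}+\overset{1}{B'}\overset{2}{\mathbb A'}(Q'_{12})^{t_2}\bigr),$$ where $Q'_{12}$ is of type (iii) if $Q_{12}$ is of type (ii), and of type (ii) if $Q_{12}$ is of type (iii). (If instead $Q_{12}=0$, so that $\mathbb A$ and $B$ Poisson commute, then so do $\mathbb A'$ and $B'$.)
   Context: $E_{i,j}$ are the $N\times N$ matrix units. For an $N\times N$ matrix $X$ write $\overset{1}{X}=X\otimes I$, $\overset{2}{X}=I\otimes X$, and $X^{-\mathrm T}=(X^{-1})^{\mathrm T}$. For $T\in \mathrm{Mat}_N\otimes\mathrm{Mat}_N$, $T^{t_1}$ and $T^{t_2}$ denote transposition in the first, respectively second, tensor factor. $\{\overset{1}{X},\overset{2}{Y}\}=\sum_{i,j,k,l}\{x_{i,j},y_{k,l}\}E_{i,j}\otimes E_{k,l}$. The classical $r$-matrix is $$r_{12}=\sum_i E_{i,i}\otimes E_{i,i}+2\sum_{i>j}E_{i,j}\otimes E_{j,i}.$$ *)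

theory Defs
  imports "HOL-Analysis.Analysis"
begin

section \<open>Tensor products of matrices and the r-matrix\<close>

text \<open>
  \<open>N\<times>N\<close> matrices are indexed by a finite linearly ordered type \<open>'n\<close> with \<open>N\<close> elements (the order
  enters the r-matrix). \<open>Mat\<^sub>N \<otimes> Mat\<^sub>N\<close> is realised as matrices indexed by pairs, so that
  \<open>E\<^sub>i\<^sub>j \<otimes> E\<^sub>k\<^sub>l\<close> has its only nonzero entry in row \<open>(i, k)\<close> and column \<open>(j, l)\<close>, and the product
  is the usual matrix product.
\<close>

type_synonym 'n cmat = "complex ^ 'n ^ 'n"
type_synonym 'n cmat2 = "complex ^ ('n \<times> 'n) ^ ('n \<times> 'n)"

definition mat_unit :: "'n \<Rightarrow> 'n \<Rightarrow> 'n::finite cmat" where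
  "mat_unit i j = (\<chi> a b. if a = i \<and> b = j then 1 else 0)"

definition kron :: "'n::finite cmat \<Rightarrow> 'n cmat \<Rightarrow> 'n cmat2" (infixl "\<otimes>" 75) where
  "X \<otimes> Y = (\<chi> a b. X $ fst a $ fst b * Y $ snd a $ snd b)"

definition in1 :: "'n::finite cmat \<Rightarrow> 'n cmat2" where
  "in1 X = X \<otimes> mat 1"

definition in2 :: "'n::finite cmat \<Rightarrow> 'n cmat2" where
  "in2 X = mat 1 \<otimes> X"

definition t1 :: "'n::finite cmat2 \<Rightarrow> 'n cmat2" where
  "t1 T = (\<chi> a b. T $ (fst b, snd a) $ (fst a, snd b))"

definition t2 :: "'n::finite cmat2 \<Rightarrow> 'n cmat2" where
  "t2 T = (\<chi> a b. T $ (fst a, snd b) $ (fst b, snd a))"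

definition cscale :: "complex \<Rightarrow> 'n::finite cmat2 \<Rightarrow> 'n cmat2" where
  "cscale c T = (\<chi> a b. c * T $ a $ b)"

definition r12 :: "'n::{finite,linorder} cmat2" where
  "r12 = (\<Sum>i\<in>UNIV. mat_unit i i \<otimes> mat_unit i i)
       + cscale 2 (\<Sum>(i, j)\<in>{(i, j). i > j}. mat_unit i j \<otimes> mat_unit j i)"

definition Q_ii :: "'n::{finite,linorder} cmat2" where
  "Q_ii = - t2 r12"

definition Q_iii :: "'n::{finite,linorder} cmat2" where
  "Q_iii = t1 r12"


section \<open>Poisson algebras of functions\<close>

text \<open>
  A complex Poisson algebra of functions on \<open>'p\<close>: a subalgebra \<open>F\<close> of all complex-valued
  functions, with a Poisson bracket on \<open>F\<close>. Values of \<open>br\<close> outside \<open>F\<close> are irrelevant.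
\<close>

locale poisson_algebra =
  fixes F :: "('p \<Rightarrow> complex) set"
    and br :: "('p \<Rightarrow> complex) \<Rightarrow> ('p \<Rightarrow> complex) \<Rightarrow> 'p \<Rightarrow> complex"
  assumes const_closed: "(\<lambda>_. c) \<in> F"
    and add_closed: "f \<in> F \<Longrightarrow> g \<in> F \<Longrightarrow> (\<lambda>p. f p + g p) \<in> F"
    and mult_closed: "f \<in> F \<Longrightarrow> g \<in> F \<Longrightarrow> (\<lambda>p. f p * g p) \<in> F"
    and br_closed: "f \<in> F \<Longrightarrow> g \<in> F \<Longrightarrow> br f g \<in> F"
    and br_antisym: "f \<in> F \<Longrightarrow> g \<in> F \<Longrightarrow> br f g p = - br g f p"
    and br_add: "f \<in> F \<Longrightarrow> g \<in> F \<Longrightarrow> h \<in> F \<Longrightarrow>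
          br f (\<lambda>p. g p + h p) p = br f g p + br f h p"
    and br_scale: "f \<in> F \<Longrightarrow> g \<in> F \<Longrightarrow> br f (\<lambda>p. c * g p) p = c * br f g p"
    and br_leibniz: "f \<in> F \<Longrightarrow> g \<in> F \<Longrightarrow> h \<in> F \<Longrightarrow>
          br f (\<lambda>p. g p * h p) p = br f g p * h p + g p * br f h p"
    and br_jacobi: "f \<in> F \<Longrightarrow> g \<in> F \<Longrightarrow> h \<in> F \<Longrightarrow>
          br f (br g h) p + br g (br h f) p + br h (br f g) p = 0"

definition mat_br ::
  "(('p \<Rightarrow> complex) \<Rightarrow> ('p \<Rightarrow> complex) \<Rightarrow> 'p \<Rightarrow> complex) \<Rightarrow>
   ('p \<Rightarrow> 'n::finite cmat) \<Rightarrow> ('p \<Rightarrow> 'n cmat) \<Rightarrow> 'p \<Rightarrow> 'n cmat2" where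
  "mat_br br X Y p =
     (\<Sum>i\<in>UNIV. \<Sum>j\<in>UNIV. \<Sum>k\<in>UNIV. \<Sum>l\<in>UNIV.
        cscale (br (\<lambda>q. X q $ i $ j) (\<lambda>q. Y q $ k $ l) p) (mat_unit i j \<otimes> mat_unit k l))"


section \<open>The phase space\<close>

typedef (overloaded) 'n GL = "{X :: 'n::finite cmat. invertible X}"
  by (rule exI[of _ "mat 1"]) (auto simp: invertible_def)

text \<open>A point of \<open>GL\<^sub>N(\<complex>) \<times> GL\<^sub>N(\<complex>)\<close> is the pair of matrices \<open>(\<A>, B)\<close>.\<close>

type_synonym 'n phase_space = "'n GL \<times> 'n GL"

definition matA :: "'n::finite phase_space \<Rightarrow> 'n cmat" where
  "matA p = Rep_GL (fst p)"

definition matB :: "'n::finite phase_space \<Rightarrow> 'n cmat" where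
  "matB p = Rep_GL (snd p)"

definition matA' :: "'n::finite phase_space \<Rightarrow> 'n cmat" where
  "matA' p = matrix_inv (matA p)"

definition matB' :: "'n::finite phase_space \<Rightarrow> 'n cmat" where
  "matB' p = transpose (matrix_inv (matB p))"

text \<open>
  The regular functions on the affine variety \<open>GL\<^sub>N \<times> GL\<^sub>N\<close>. Every usual function algebra on it
  (regular, holomorphic, smooth) contains them.
\<close>

inductive_set regular_functions :: "('n::finite phase_space \<Rightarrow> complex) set" where
  const: "(\<lambda>_. c) \<in> regular_functions"
| entryA: "(\<lambda>p. matA p $ i $ j) \<in> regular_functions"
| entryB: "(\<lambda>p. matB p $ i $ j) \<in> regular_functions"
| inv_detA: "(\<lambda>p. inverse (det (matA p))) \<in> regular_functions"
| inv_detB: "(\<lambda>p. inverse (det (matB p))) \<in> regular_functions"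
| add: "f \<in> regular_functions \<Longrightarrow> g \<in> regular_functions \<Longrightarrow> (\<lambda>p. f p + g p) \<in> regular_functions"
| mult: "f \<in> regular_functions \<Longrightarrow> g \<in> regular_functions \<Longrightarrow> (\<lambda>p. f p * g p) \<in> regular_functions"


section \<open>Right-hand sides of the bracket relations\<close>

definition rhs_AA :: "'n::{finite,linorder} cmat \<Rightarrow> 'n cmat2" where
  "rhs_AA X = r12 ** in1 X ** in2 X - in1 X ** in2 X ** r12
            + in1 X ** t1 r12 ** in2 X - in2 X ** t1 r12 ** in1 X"

definition rhs_BB :: "'n::{finite,linorder} cmat \<Rightarrow> 'n cmat2" where
  "rhs_BB Y = r12 ** in1 Y ** in2 Y - in1 Y ** in2 Y ** r12"

definition rhs_BA :: "'n::finite cmat2 \<Rightarrow> 'n cmat \<Rightarrow> 'n cmat \<Rightarrow> 'n cmat2" where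
  "rhs_BA Q Y X = in1 Y ** Q ** in2 X + in1 Y ** in2 X ** t2 Q"

end

(*
  Every bracket of inverse matrices follows from the derivation rule
  {Y_1, (X^-1)_2} = - (X^-1)_2 {Y_1, X_2} (X^-1)_2 and its mirror image in the first factor.
  For the transposed inverse B' one then applies t1 or t2, which reverses the order of the
  products in one tensor factor and turns r_12 into its full transpose r_21. The relation for
  {B', B'} has r_21 in place of r_12; since r_12 + r_21 is twice the permutation operator, which
  commutes with B'_1 B'_2, the exchange only costs a sign. For {B', A'} it yields
  Q' = - Q^(t1 t2), which swaps the types (ii) and (iii).
*)
theory Submission
  imports Defs
begin

section \<open>Matrices over the tensor square\<close>

lemma matrix_mult_nth: "(A ** B) $ i $ j = (\<Sum>m\<in>UNIV. A $ i $ m * B $ m $ j)"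
  by (simp add: matrix_matrix_mult_def)

lemma matrix_add_rdistrib: "(A + B) ** C = A ** C + B ** (C :: 'a::ring_1 ^ 'k ^ 'n)"
  by (simp add: matrix_matrix_mult_def vec_eq_iff distrib_right sum.distrib)

lemma matrix_diff_ldistrib: "A ** (B - C) = A ** B - A ** (C :: 'a::ring_1 ^ 'k ^ 'n)"
  by (simp add: matrix_matrix_mult_def vec_eq_iff right_diff_distrib sum_subtractf)

lemma matrix_diff_rdistrib: "(A - B) ** C = A ** C - B ** (C :: 'a::ring_1 ^ 'k ^ 'n)"
  by (simp add: matrix_matrix_mult_def vec_eq_iff left_diff_distrib sum_subtractf)

lemma matrix_minus_left: "(- A) ** C = - (A ** (C :: 'a::ring_1 ^ 'k ^ 'n))"
  by (simp add: matrix_matrix_mult_def vec_eq_iff sum_negf)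

lemma matrix_minus_right: "A ** (- C) = - (A ** (C :: 'a::ring_1 ^ 'k ^ 'n))"
  by (simp add: matrix_matrix_mult_def vec_eq_iff sum_negf)

lemma matrix_inv_inverse:
  assumes "invertible A"
  shows "A ** matrix_inv A = mat 1" "matrix_inv A ** A = mat 1"
  using someI_ex[OF assms[unfolded invertible_def]] by (simp_all add: matrix_inv_def)

lemma sum_UNIV_prod: "(\<Sum>c\<in>(UNIV :: ('a::finite \<times> 'b::finite) set). f c) = (\<Sum>i\<in>UNIV. \<Sum>j\<in>UNIV. f (i, j))"
  by (simp add: sum.cartesian_product flip: UNIV_Times_UNIV)

lemma in1_nth: "in1 X $ (i, k) $ (j, l) = (if k = l then X $ i $ j else 0)"
  by (simp add: in1_def kron_def mat_def)

lemma in2_nth: "in2 X $ (i, k) $ (j, l) = (if i = j then X $ k $ l else 0)"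
  by (simp add: in2_def kron_def mat_def)

text \<open>Pulls Kronecker deltas to the front of each summand, where a sum over the delta's index
  collapses.\<close>

lemma mult_delta_if: "(if P then x else 0) * y = (if P then x * y else 0)"
    "y * (if P then x else 0) = (if P then y * x else (0 :: complex))"
  by simp_all

text \<open>For a delta in the outer index of a double sum: it is constant for the inner sum and has
  to leave it before the outer sum can collapse.\<close>

lemma sum_if_const: "(\<Sum>m\<in>S. if P then f m else 0) = (if P then \<Sum>m\<in>S. f m else 0)"
  by simp

lemma in1_mult_nth: "(in1 X ** T) $ (i, k) $ (j, l) = (\<Sum>m\<in>UNIV. X $ i $ m * T $ (m, k) $ (j, l))"
  by (simp add: matrix_mult_nth sum_UNIV_prod in1_nth mult_delta_if)

lemma in2_mult_nth: "(in2 X ** T) $ (i, k) $ (j, l) = (\<Sum>m\<in>UNIV. X $ k $ m * T $ (i, m) $ (j, l))"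
  by (simp add: matrix_mult_nth sum_UNIV_prod in2_nth mult_delta_if sum_if_const)

lemma mult_in1_nth: "(T ** in1 X) $ (i, k) $ (j, l) = (\<Sum>m\<in>UNIV. T $ (i, k) $ (m, l) * X $ m $ j)"
  by (simp add: matrix_mult_nth sum_UNIV_prod in1_nth mult_delta_if)

lemma mult_in2_nth: "(T ** in2 X) $ (i, k) $ (j, l) = (\<Sum>m\<in>UNIV. T $ (i, k) $ (j, m) * X $ m $ l)"
  by (simp add: matrix_mult_nth sum_UNIV_prod in2_nth mult_delta_if sum_if_const)

lemma in1_one: "in1 (mat 1) = mat 1"
  by (auto simp: vec_eq_iff in1_nth mat_def)

lemma in2_one: "in2 (mat 1) = mat 1"
  by (auto simp: vec_eq_iff in2_nth mat_def)

lemma in1_mult: "in1 X ** in1 Y = in1 (X ** Y)"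
  by (simp add: vec_eq_iff in1_mult_nth in1_nth mult_delta_if sum_if_const) (simp add: matrix_mult_nth)

lemma in2_mult: "in2 X ** in2 Y = in2 (X ** Y)"
  by (simp add: vec_eq_iff in2_mult_nth in2_nth mult_delta_if sum_if_const) (simp add: matrix_mult_nth)

lemma in2_in1_commute: "in2 Y ** in1 X = in1 X ** in2 Y"
  by (simp add: vec_eq_iff in1_mult_nth mult_in1_nth in2_nth mult_delta_if mult.commute)

lemma in1_mult_left: "in1 X ** (in1 Y ** T) = in1 (X ** Y) ** T"
  by (simp add: matrix_mul_assoc in1_mult)

lemma in2_mult_left: "in2 X ** (in2 Y ** T) = in2 (X ** Y) ** T"
  by (simp add: matrix_mul_assoc in2_mult)

lemma in2_in1_left_commute: "in2 Y ** (in1 X ** T) = in1 X ** (in2 Y ** T)"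
  by (metis matrix_mul_assoc in2_in1_commute)

lemmas matrix_ring_simps = matrix_add_ldistrib matrix_add_rdistrib matrix_diff_ldistrib
  matrix_diff_rdistrib matrix_minus_left matrix_minus_right

text \<open>Normal form: sums of right-nested products in which \<open>in1\<close> precedes an
  adjacent \<open>in2\<close> and neighbours in the same leg are merged. The \<open>left\<close>
  variants reach neighbours that are followed by a further factor.\<close>

lemmas tensor_normalize = matrix_ring_simps matrix_mul_assoc[symmetric] in1_one in2_one in1_mult
  in2_mult in2_in1_commute in1_mult_left in2_mult_left in2_in1_left_commute


section \<open>Partial transpositions\<close>

lemma t1_nth: "t1 T $ (i, k) $ (j, l) = T $ (j, k) $ (i, l)"
  by (simp add: t1_def)

lemma t2_nth: "t2 T $ (i, k) $ (j, l) = T $ (i, l) $ (j, k)"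
  by (simp add: t2_def)

lemma t1_add: "t1 (S + T) = t1 S + t1 T" and t1_diff: "t1 (S - T) = t1 S - t1 T"
  and t1_minus: "t1 (- T) = - t1 T"
  by (simp_all add: vec_eq_iff t1_nth)

lemma t2_diff: "t2 (S - T) = t2 S - t2 T"
  and t2_minus: "t2 (- T) = - t2 T"
  by (simp_all add: vec_eq_iff t2_nth)

lemma t1_t1: "t1 (t1 T) = T" and t2_t2: "t2 (t2 T) = T" and t1_t2: "t1 (t2 T) = t2 (t1 T)"
  by (simp_all add: vec_eq_iff t1_nth t2_nth)

text \<open>A partial transposition is neither multiplicative nor antimultiplicative, but factors
  living in one leg obey clean rules: those in the transposed leg change sides and get transposed,
  those in the other leg stay.\<close>

lemma t1_in1_mult: "t1 (in1 X ** T) = t1 T ** in1 (transpose X)"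
  by (simp add: vec_eq_iff t1_nth in1_mult_nth mult_in1_nth transpose_def mult.commute)

lemma t1_mult_in1: "t1 (T ** in1 X) = in1 (transpose X) ** t1 T"
  by (simp add: vec_eq_iff t1_nth in1_mult_nth mult_in1_nth transpose_def mult.commute)

lemma t1_in2_mult: "t1 (in2 X ** T) = in2 X ** t1 T"
  by (simp add: vec_eq_iff t1_nth in2_mult_nth)

lemma t1_mult_in2: "t1 (T ** in2 X) = t1 T ** in2 X"
  by (simp add: vec_eq_iff t1_nth mult_in2_nth)

lemma t2_in2_mult: "t2 (in2 X ** T) = t2 T ** in2 (transpose X)"
  by (simp add: vec_eq_iff t2_nth in2_mult_nth mult_in2_nth transpose_def mult.commute)

lemma t2_mult_in2: "t2 (T ** in2 X) = in2 (transpose X) ** t2 T"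
  by (simp add: vec_eq_iff t2_nth in2_mult_nth mult_in2_nth transpose_def mult.commute)

lemma t2_in1_mult: "t2 (in1 X ** T) = in1 X ** t2 T"
  by (simp add: vec_eq_iff t2_nth in1_mult_nth)

lemma t2_mult_in1: "t2 (T ** in1 X) = t2 T ** in1 X"
  by (simp add: vec_eq_iff t2_nth mult_in1_nth)


section \<open>The r-matrix and the permutation operator\<close>

lemma mat_unit_nth: "mat_unit i j $ a $ b = (if i = a \<and> j = b then 1 else 0)"
  by (auto simp: mat_unit_def)

lemma kron_nth: "(X \<otimes> Y) $ (i, k) $ (j, l) = X $ i $ j * Y $ k $ l"
  by (simp add: kron_def)

text \<open>\<open>E_ij\<close> \<otimes> \<open>E_ji\<close> sits in row \<open>(i, j)\<close> and
  column \<open>(j, i)\<close>, so all entries lie where the flip has its ones, weighted by the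
  order of \<open>a\<close> and \<open>b\<close>.\<close>

lemma r12_nth:
  "r12 $ (a, b) $ (c, d) =
     (if a = d \<and> b = c then if a = b then 1 else if a > b then 2 else 0 else 0)"
proof -
  \<comment> \<open>The condition is regrouped with \<open>i = a\<close> outermost so that the sum
    collapses as a delta.\<close>
  have "(\<Sum>i\<in>UNIV. (mat_unit i i \<otimes> mat_unit i i) $ (a, b) $ (c, d))
      = (\<Sum>i\<in>UNIV. if i = a then if i = b \<and> i = c \<and> i = d then 1 else 0 else 0)"
    by (intro sum.cong refl) (simp add: kron_nth mat_unit_nth, metis)
  also have "\<dots> = (if a = b \<and> a = c \<and> a = d then 1 else 0)"
    by simp
  finally have diag: "(\<Sum>i\<in>UNIV. (mat_unit i i \<otimes> mat_unit i i) $ (a, b) $ (c, d)) = \<dots>" .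
  have "(\<Sum>x\<in>{x. snd x < fst x}. (mat_unit (fst x) (snd x) \<otimes> mat_unit (snd x) (fst x)) $ (a, b) $ (c, d))
      = (\<Sum>x\<in>{x. snd x < fst x}. if x = (a, b) then if a = d \<and> b = c then 1 else 0 else 0)"
    by (rule sum.cong) (auto simp: kron_def mat_unit_nth)
  also have "\<dots> = (if a > b \<and> a = d \<and> b = c then 1 else 0)"
    by simp
  finally have off: "(\<Sum>x\<in>{x. snd x < fst x}.
      (mat_unit (fst x) (snd x) \<otimes> mat_unit (snd x) (fst x)) $ (a, b) $ (c, d)) = \<dots>" .
  have "r12 $ (a, b) $ (c, d) = (if a = b \<and> a = c \<and> a = d then 1 else 0)
      + 2 * (if a > b \<and> a = d \<and> b = c then 1 else 0)"
    by (simp only: r12_def cscale_def case_prod_unfold vector_add_component sum_component vec_lambda_beta diag off)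
  also have "\<dots> = (if a = d \<and> b = c then if a = b then 1 else if a > b then 2 else 0 else 0)"
    by (cases "a = b"; cases "a = d"; cases "b = c") simp_all
  finally show ?thesis .
qed

definition perm_op :: "'n::finite cmat2" where
  "perm_op = (\<chi> a b. if fst a = snd b \<and> snd a = fst b then 1 else 0)"

text \<open>Full transposition exchanges the weights 2 and 0 off the diagonal and keeps the 1 on it,
  so the two weights always add up to 2.\<close>

lemma r12_plus_r21: "r12 + t1 (t2 r12) = perm_op + (perm_op :: 'n::{finite,linorder} cmat2)"
proof -
  have "(r12 + t1 (t2 r12)) $ (a, b) $ (c, d) = (perm_op + perm_op) $ (a, b) $ (c, d)" for a b c d :: 'n
    by (cases "a = d"; cases "b = c"; cases a b rule: linorder_cases)
      (simp_all add: t1_nth t2_nth r12_nth perm_op_def, (blast dest: less_asym)+)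
  then show ?thesis
    by (simp add: vec_eq_iff)
qed

lemma perm_op_nth: "perm_op $ (i, k) $ (j, l) = (if j = k then if l = i then 1 else 0 else 0)"
  by (simp add: perm_op_def)

lemma perm_op_mult_nth: "(perm_op ** T) $ (i, k) $ c = T $ (k, i) $ c"
  by (simp add: matrix_mult_nth sum_UNIV_prod perm_op_nth mult_delta_if sum_if_const)

lemma mult_perm_op_nth: "(T ** perm_op) $ c $ (j, l) = T $ c $ (l, j)"
proof -
  \<comment> \<open>Here the row indices are summed, so the condition is solved for \<open>i\<close>
    and \<open>k\<close>, unlike in \<open>perm_op_nth\<close>.\<close>
  have "perm_op $ (i, k) $ (j, l) = (if i = l then if k = j then 1 else 0 else 0)" for i k
    by (simp add: perm_op_def)
  then show ?thesis
    by (simp add: matrix_mult_nth sum_UNIV_prod mult_delta_if sum_if_const)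
qed

text \<open>Moving the flip across a product exchanges its legs, and both legs carry the same
  \<open>X\<close>.\<close>

lemma perm_op_commute: "perm_op ** (in1 X ** in2 X) = in1 X ** (in2 X ** perm_op)"
  unfolding matrix_mul_assoc
  by (simp add: vec_eq_iff perm_op_mult_nth mult_perm_op_nth in1_mult_nth in2_nth mult_delta_if
      mult.commute flip: matrix_mul_assoc)

lemma r21_commutator:
  "t1 (t2 r12) ** (in1 X ** in2 X) - in1 X ** (in2 X ** t1 (t2 r12))
     = - (r12 ** (in1 X ** in2 X) - in1 X ** (in2 X ** r12))"
proof -
  have r21: "t1 (t2 r12) = perm_op + perm_op - (r12 :: 'a cmat2)"
    using r12_plus_r21 by (simp add: algebra_simps)
  show ?thesis
    unfolding r21 matrix_ring_simps perm_op_commute by simp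
qed


section \<open>Matrix brackets\<close>

lemma mat_br_nth:
  "mat_br br X Y p $ (i, k) $ (j, l) = br (\<lambda>q. X q $ i $ j) (\<lambda>q. Y q $ k $ l) p"
proof -
  \<comment> \<open>The conditions are nested with the innermost summation index outermost, so that
    the four sums collapse from the inside.\<close>
  have "mat_br br X Y p $ (i, k) $ (j, l) =
      (\<Sum>i'\<in>UNIV. \<Sum>j'\<in>UNIV. \<Sum>k'\<in>UNIV. \<Sum>l'\<in>UNIV.
         if l' = l then if k' = k then if j' = j then if i' = i
         then br (\<lambda>q. X q $ i' $ j') (\<lambda>q. Y q $ k' $ l') p else 0 else 0 else 0 else 0)"
    unfolding mat_br_def sum_component
    by (intro sum.cong refl) (auto simp: cscale_def kron_def mat_unit_nth)
  then show ?thesis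
    by simp
qed

lemma mat_br_transpose_left: "mat_br br (\<lambda>q. transpose (X q)) Y p = t1 (mat_br br X Y p)"
  by (simp add: vec_eq_iff t1_nth mat_br_nth transpose_def)

lemma mat_br_transpose_right: "mat_br br X (\<lambda>q. transpose (Y q)) p = t2 (mat_br br X Y p)"
  by (simp add: vec_eq_iff t2_nth mat_br_nth transpose_def)

context poisson_algebra
begin

text \<open>The bracket laws are assumed for members of \<open>F\<close> only, so this is the domain
  condition of the matrix identities.\<close>

definition entries_in :: "('p \<Rightarrow> 'n::finite cmat) \<Rightarrow> bool" where
  "entries_in X \<longleftrightarrow> (\<forall>i j. (\<lambda>q. X q $ i $ j) \<in> F)"

lemma sum_closed: "finite S \<Longrightarrow> (\<And>m. m \<in> S \<Longrightarrow> g m \<in> F) \<Longrightarrow> (\<lambda>q. \<Sum>m\<in>S. g m q) \<in> F"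
  by (induction S rule: finite_induct) (auto intro: const_closed add_closed)

text \<open>Leibniz for 1 = 1 * 1 gives \<open>br f 1 = 2 * br f 1\<close>, which kills constant 1;
  linearity does the rest.\<close>

lemma br_const:
  assumes "f \<in> F"
  shows "br f (\<lambda>_. c) p = 0"
  using br_scale[OF assms const_closed, of c 1]
    br_leibniz[OF assms const_closed const_closed, of 1 1 p]
  by simp

lemma br_sum:
  assumes "finite S" "f \<in> F" "\<And>m. m \<in> S \<Longrightarrow> g m \<in> F"
  shows "br f (\<lambda>q. \<Sum>m\<in>S. g m q) p = (\<Sum>m\<in>S. br f (g m) p)"
  using assms(1,3)
proof (induction S rule: finite_induct)
  case empty
  then show ?case by (simp add: br_const assms(2))
next
  case (insert x S)
  then show ?case by (simp add: br_add sum_closed assms(2))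
qed

section \<open>Product and inverse rules for matrix brackets\<close>

lemma mat_br_mult_right:
  assumes "entries_in Y" "entries_in X" "entries_in Z"
  shows "mat_br br Y (\<lambda>q. X q ** Z q) p = mat_br br Y X p ** in2 (Z p) + in2 (X p) ** mat_br br Y Z p"
  using assms unfolding entries_in_def
  by (simp add: vec_eq_iff mat_br_nth in2_mult_nth mult_in2_nth)
    (simp add: matrix_mult_nth br_sum br_leibniz mult_closed sum.distrib)

text \<open>The Leibniz axiom concerns the second argument, so antisymmetry moves the product there
  and back.\<close>

lemma mat_br_mult_left:
  assumes "entries_in Y" "entries_in X" "entries_in Z"
  shows "mat_br br (\<lambda>q. X q ** Z q) Y p = mat_br br X Y p ** in1 (Z p) + in1 (X p) ** mat_br br Z Y p"
proof -
  have "mat_br br (\<lambda>q. X q ** Z q) Y p $ (i, k) $ (j, l)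
      = (mat_br br X Y p ** in1 (Z p) + in1 (X p) ** mat_br br Z Y p) $ (i, k) $ (j, l)" for i j k l
  proof -
    let ?y = "\<lambda>q. Y q $ k $ l"
    have F: "?y \<in> F" "(\<lambda>q. X q $ a $ b) \<in> F" "(\<lambda>q. Z q $ a $ b) \<in> F" for a b
      using assms by (auto simp: entries_in_def)
    have "br (\<lambda>q. \<Sum>m\<in>UNIV. X q $ i $ m * Z q $ m $ j) ?y p
        = - br ?y (\<lambda>q. \<Sum>m\<in>UNIV. X q $ i $ m * Z q $ m $ j) p"
      by (intro br_antisym sum_closed mult_closed F) auto
    also have "\<dots> = (\<Sum>m\<in>UNIV. - br ?y (\<lambda>q. X q $ i $ m) p * Z p $ m $ j
                            + X p $ i $ m * - br ?y (\<lambda>q. Z q $ m $ j) p)"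
      by (simp add: br_sum br_leibniz mult_closed F sum_negf sum.distrib sum_subtractf)
    also have "\<dots> = (\<Sum>m\<in>UNIV. br (\<lambda>q. X q $ i $ m) ?y p * Z p $ m $ j
                            + X p $ i $ m * br (\<lambda>q. Z q $ m $ j) ?y p)"
      by (simp only: br_antisym[OF F(2) F(1)] br_antisym[OF F(3) F(1)])
    finally show ?thesis
      by (simp add: mat_br_nth in1_mult_nth mult_in1_nth) (simp add: matrix_mult_nth sum.distrib)
  qed
  then show ?thesis
    by (simp add: vec_eq_iff)
qed

lemma mat_br_const_right: "entries_in Y \<Longrightarrow> mat_br br Y (\<lambda>_. C) p = 0"
  by (simp add: vec_eq_iff mat_br_nth entries_in_def br_const)

lemma mat_br_const_left: "entries_in Y \<Longrightarrow> mat_br br (\<lambda>_. C) Y p = 0"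
  by (simp add: vec_eq_iff mat_br_nth entries_in_def br_antisym[OF const_closed] br_const)

text \<open>The bracket of \<open>Y\<close> with the constant \<open>X ** Z\<close> vanishes; expand
  it by the product rule and multiply by \<open>in2 (Z p)\<close> from the left.\<close>

lemma mat_br_inverse_right:
  assumes "entries_in Y" "entries_in X" "entries_in Z"
    and inv: "\<And>q. X q ** Z q = mat 1" "\<And>q. Z q ** X q = mat 1"
  shows "mat_br br Y Z p = - (in2 (Z p) ** mat_br br Y X p ** in2 (Z p))"
proof -
  have "mat_br br Y X p ** in2 (Z p) + in2 (X p) ** mat_br br Y Z p = 0"
    using mat_br_mult_right[OF assms(1-3)] mat_br_const_right[OF assms(1)] by (simp add: inv)
  then have "in2 (Z p) ** (mat_br br Y X p ** in2 (Z p) + in2 (X p) ** mat_br br Y Z p) = 0"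
    by simp
  then show ?thesis
    by (simp add: tensor_normalize inv eq_neg_iff_add_eq_0 add.commute)
qed

lemma mat_br_inverse_left:
  assumes "entries_in Y" "entries_in X" "entries_in Z"
    and inv: "\<And>q. X q ** Z q = mat 1" "\<And>q. Z q ** X q = mat 1"
  shows "mat_br br Z Y p = - (in1 (Z p) ** mat_br br X Y p ** in1 (Z p))"
proof -
  have "mat_br br X Y p ** in1 (Z p) + in1 (X p) ** mat_br br Z Y p = 0"
    using mat_br_mult_left[OF assms(1-3)] mat_br_const_left[OF assms(1)] by (simp add: inv)
  then have "in1 (Z p) ** (mat_br br X Y p ** in1 (Z p) + in1 (X p) ** mat_br br Z Y p) = 0"
    by simp
  then show ?thesis
    by (simp add: tensor_normalize inv eq_neg_iff_add_eq_0 add.commute)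
qed

text \<open>The inverse rules for the two legs are applied in turn, and their signs cancel.\<close>

lemma mat_br_inverse_both:
  assumes "entries_in X" "entries_in Z" "entries_in X'" "entries_in Z'"
    and "\<And>q. X q ** Z q = mat 1" "\<And>q. Z q ** X q = mat 1"
    and "\<And>q. X' q ** Z' q = mat 1" "\<And>q. Z' q ** X' q = mat 1"
  shows "mat_br br Z Z' p =
           in1 (Z p) ** in2 (Z' p) ** mat_br br X X' p ** in1 (Z p) ** in2 (Z' p)"
  using assms
  by (simp add: mat_br_inverse_right[of Z X' Z'] mat_br_inverse_left[of X' X Z] tensor_normalize)

end


section \<open>Regular functions\<close>

lemma regular_sum:
  "finite S \<Longrightarrow> (\<And>m. m \<in> S \<Longrightarrow> g m \<in> regular_functions) \<Longrightarrow> (\<lambda>q. \<Sum>m\<in>S. g m q) \<in> regular_functions"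
  by (induction S rule: finite_induct) (simp_all add: regular_functions.intros)

lemma regular_prod:
  "finite S \<Longrightarrow> (\<And>m. m \<in> S \<Longrightarrow> g m \<in> regular_functions) \<Longrightarrow> (\<lambda>q. \<Prod>m\<in>S. g m q) \<in> regular_functions"
  by (induction S rule: finite_induct) (simp_all add: regular_functions.intros)

lemma regular_det:
  assumes "\<And>i j. (\<lambda>q. M q $ i $ j) \<in> regular_functions"
  shows "(\<lambda>q. det (M q)) \<in> regular_functions"
  unfolding det_def
  by (intro regular_sum regular_prod regular_functions.mult regular_functions.const assms) simp_all

text \<open>Column \<open>l\<close> of the inverse solves \<open>A *v x = e_l\<close>, so Cramer's
  rule writes its entries through determinants.\<close>

lemma matrix_inv_cramer:
  fixes A :: "'n::finite cmat"
  assumes "invertible A"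
  shows "matrix_inv A $ k $ l =
           det (\<chi> i j. if j = k then mat 1 $ i $ l else A $ i $ j) * inverse (det A)"
proof -
  have "(A *v column l (matrix_inv A)) $ i = (A ** matrix_inv A) $ i $ l" for i
    by (simp add: matrix_vector_mult_def matrix_matrix_mult_def column_def)
  then have "det (\<chi> i j. if j = k then mat 1 $ i $ l else A $ i $ j) = matrix_inv A $ k $ l * det A"
    using cramer_lemma[of k A "column l (matrix_inv A)"] matrix_inv_inverse(1)[OF assms]
    by (simp add: column_def cong: if_cong)
  then show ?thesis
    using assms by (simp add: invertible_det_nz)
qed

text \<open>Regularity of the inverse determinant is a hypothesis; for \<open>matA\<close> and
  \<open>matB\<close> it is one of the generators.\<close>

lemma regular_matrix_inv:
  assumes "\<And>q. invertible (M q)"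
    and "\<And>i j. (\<lambda>q. M q $ i $ j) \<in> regular_functions"
    and "(\<lambda>q. inverse (det (M q))) \<in> regular_functions"
  shows "(\<lambda>q. matrix_inv (M q) $ k $ l) \<in> regular_functions"
proof -
  have "(\<lambda>q. (\<chi> i j. if j = k then mat 1 $ i $ l else M q $ i $ j) $ a $ b) \<in> regular_functions" for a b
    by (cases "b = k") (simp_all add: assms(2) regular_functions.const)
  then show ?thesis
    unfolding matrix_inv_cramer[OF assms(1)] by (intro regular_functions.mult regular_det assms(3))
qed

lemma invertible_matA: "invertible (matA p)" and invertible_matB: "invertible (matB p)"
  using Rep_GL by (auto simp: matA_def matB_def)

section \<open>Transport of the bracket relations to the inverse matrices\<close>

theorem lemma2p3:
  fixes F :: "('n::{finite,linorder} phase_space \<Rightarrow> complex) set"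
    and br :: "('n phase_space \<Rightarrow> complex) \<Rightarrow> ('n phase_space \<Rightarrow> complex) \<Rightarrow> 'n phase_space \<Rightarrow> complex"
    and Q :: "'n cmat2"
  assumes "poisson_algebra F br"
    and "regular_functions \<subseteq> F"
    and "Q = Q_ii \<or> Q = Q_iii \<or> Q = 0"
    and "\<forall>p. mat_br br matA matA p = rhs_AA (matA p)"
    and "\<forall>p. mat_br br matB matB p = rhs_BB (matB p)"
    and "\<forall>p. mat_br br matB matA p = rhs_BA Q (matB p) (matA p)"
  shows "(\<forall>p. mat_br br matA' matA' p = - rhs_AA (matA' p))
       \<and> (\<forall>p. mat_br br matB' matB' p = - rhs_BB (matB' p))
       \<and> (Q = Q_ii \<longrightarrow> (\<forall>p. mat_br br matB' matA' p = - rhs_BA Q_iii (matB' p) (matA' p)))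
       \<and> (Q = Q_iii \<longrightarrow> (\<forall>p. mat_br br matB' matA' p = - rhs_BA Q_ii (matB' p) (matA' p)))
       \<and> (Q = 0 \<longrightarrow> (\<forall>p. mat_br br matB' matA' p = 0))"
proof -
  interpret poisson_algebra F br by (rule assms(1))
  \<comment> \<open>The inverse rules apply to the plain inverse of \<open>matB\<close>; the
    transposition follows afterwards through \<open>t1\<close> and \<open>t2\<close>.\<close>
  define C where "C = (\<lambda>q :: 'n phase_space. matrix_inv (matB q))"
  have A: "entries_in matA" and B: "entries_in matB"
    unfolding entries_in_def
    by (intro allI subsetD[OF assms(2)] regular_functions.entryA regular_functions.entryB)+
  have A': "entries_in matA'"
    unfolding entries_in_def matA'_def
    by (intro allI subsetD[OF assms(2)] regular_matrix_inv invertible_matA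
        regular_functions.entryA regular_functions.inv_detA)
  have C: "entries_in C"
    unfolding entries_in_def C_def
    by (intro allI subsetD[OF assms(2)] regular_matrix_inv invertible_matB
        regular_functions.entryB regular_functions.inv_detB)
  have invA: "matA q ** matA' q = mat 1" "matA' q ** matA q = mat 1" for q :: "'n phase_space"
    by (simp_all add: matA'_def matrix_inv_inverse invertible_matA)
  have invB: "matB q ** C q = mat 1" "C q ** matB q = mat 1" for q
    by (simp_all add: C_def matrix_inv_inverse invertible_matB)
  have B'_eq: "matB' = (\<lambda>q. transpose (C q))"
    by (simp add: fun_eq_iff matB'_def C_def)
  \<comment> \<open>Multiplying by \<open>A'_1 A'_2\<close> on both sides swaps the first two terms
    of \<open>rhs_AA\<close> with each other, and likewise the last two; this is the overall
    sign.\<close>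
  have AA: "mat_br br matA' matA' p = - rhs_AA (matA' p)" for p
    by (simp add: mat_br_inverse_both[OF A A' A A' invA invA] assms(4)[rule_format] rhs_AA_def tensor_normalize invA)
  have BB: "mat_br br matB' matB' p = - rhs_BB (matB' p)" for p
  proof -
    \<comment> \<open>The products are associated so that the transposition rules can peel off one
      outer factor at a time.\<close>
    have CC: "mat_br br C C p = in1 (C p) ** (in2 (C p) ** r12) - r12 ** in1 (C p) ** in2 (C p)"
      by (simp add: mat_br_inverse_both[OF B C B C invB invB] assms(5)[rule_format] rhs_BB_def tensor_normalize invB)
    have "mat_br br matB' matB' p = t1 (t2 (mat_br br C C p))"
      unfolding B'_eq mat_br_transpose_left mat_br_transpose_right ..
    also have "\<dots> = t1 (t2 r12) ** (in1 (matB' p) ** in2 (matB' p))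
                 - in1 (matB' p) ** (in2 (matB' p) ** t1 (t2 r12))"
      unfolding CC B'_eq
      by (simp add: t1_diff t2_diff t1_in1_mult t1_mult_in1 t1_in2_mult t1_mult_in2
          t2_in1_mult t2_mult_in1 t2_in2_mult t2_mult_in2) (simp add: tensor_normalize)
    also have "\<dots> = - rhs_BB (matB' p)"
      unfolding r21_commutator by (simp add: rhs_BB_def matrix_mul_assoc)
    finally show ?thesis .
  qed
  \<comment> \<open>One formula for all three types, with \<open>Q' = - t1 (t2 Q)\<close>. Only the
    first leg is transposed, and \<open>t2 Q' = - t1 Q\<close> accounts for the other term.\<close>
  have BA: "mat_br br matB' matA' p = - rhs_BA (- t1 (t2 Q)) (matB' p) (matA' p)" for p
  proof -
    have CA: "mat_br br C matA' p = in2 (matA' p) ** Q ** in1 (C p) + t2 Q ** in1 (C p) ** in2 (matA' p)"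
      by (simp add: mat_br_inverse_both[OF B C A A' invB invA] assms(6)[rule_format] rhs_BA_def
          tensor_normalize invA invB)
    show ?thesis
      unfolding B'_eq mat_br_transpose_left CA rhs_BA_def
      by (simp add: t1_add t1_mult_in1 t1_in2_mult t1_mult_in2 t1_minus t2_minus t1_t2 t2_t2)
        (simp add: tensor_normalize)
  qed
  \<comment> \<open>\<open>t1\<close> and \<open>t2\<close> are commuting involutions, so
    \<open>Q'\<close> is \<open>t1 r12\<close> for type (ii) and \<open>- t2 r12\<close> for type
    (iii).\<close>
  have "- t1 (t2 Q_ii) = (Q_iii :: 'n cmat2)" "- t1 (t2 Q_iii) = (Q_ii :: 'n cmat2)"
    by (simp_all add: Q_ii_def Q_iii_def t2_minus t1_minus t2_t2 t1_t2 t1_t1)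
  moreover have "rhs_BA (- t1 (t2 0)) Y X = 0" for X Y :: "'n cmat"
  proof -
    have "t1 0 = (0 :: 'n cmat2)" "t2 0 = (0 :: 'n cmat2)"
      by (simp_all add: vec_eq_iff t1_nth t2_nth)
    then show ?thesis
      by (simp add: rhs_BA_def)
  qed
  ultimately show ?thesis
    using AA BB BA by (intro conjI impI allI) simp_all
qed

end
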